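(* Let $n \geq 1$ and let $G$ be the hypertree $HT(n)$. Then the locating-total domination number of $G$ is $$\gamma^{L}_t(G) = \begin{cases} \frac{1}{7}(3\cdot 2^{n+1}+1) & \text{if } n\equiv 0 \pmod 3,\\ \frac{2}{7}(3\cdot 2^{n}+1) & \text{if } n\equiv 1 \pmod 3,\\ \frac{3}{7}(2^{n+1}-1) & \text{if } n\equiv 2 \pmod 3.\end{cases}$$
   Context: The hypertree $HT(n)$ has vertex set $\{1,2,\dots,2^{n+1}-1\}$. Its edges are the edges of the complete binary tree of height $n$ in which vertex $x$ has children $2x$ and $2x+1$ (the root is $1$, at level $0$; vertex $v$ lies at level $i$ iff $2^i \le v \le 2^{i+1}-1$), together with horizontal edges: for each level $i\ge 1$, two vertices at level $i$ are adjacent if their labels differ by $2^{i-1}$. A locating-total dominating set of $G$ is a set $S\subseteq V(G)$ such that every vertex of $V(G)$ is adjacent to some vertex of $S$, and for every two distinct vertices $u,v\in V(G)\setminus S$, $N(u)\cap S\neq N(v)\cap S$ (where $N(x)$ is the open neighborhood). $\gamma^{L}_t(G)$ is the minimum cardinality of a locating-total dominating set. *)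

theory Defs
  imports Complex_Main "HOL-Number_Theory.Cong"
begin

type_synonym 'a ugraph = "'a set \<times> 'a set set"

abbreviation verts :: "'a ugraph \<Rightarrow> 'a set" where
  "verts G \<equiv> fst G"

abbreviation edges :: "'a ugraph \<Rightarrow> 'a set set" where
  "edges G \<equiv> snd G"

definition neighborhood :: "'a ugraph \<Rightarrow> 'a \<Rightarrow> 'a set" where
  "neighborhood G v = {u \<in> verts G. {u, v} \<in> edges G}"

definition locating_total_dominating :: "'a ugraph \<Rightarrow> 'a set \<Rightarrow> bool" where
  "locating_total_dominating G S \<longleftrightarrow>
     S \<subseteq> verts G \<and>
     (\<forall>v \<in> verts G. \<exists>s \<in> S. s \<in> neighborhood G v) \<and>
     (\<forall>u \<in> verts G - S. \<forall>v \<in> verts G - S. u \<noteq> v \<longrightarrow>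
        neighborhood G u \<inter> S \<noteq> neighborhood G v \<inter> S)"

text \<open>The finiteness condition is needed only because an infinite set has \<^term>\<open>card\<close> 0.\<close>

definition locating_total_domination_number :: "'a ugraph \<Rightarrow> nat" where
  "locating_total_domination_number G =
     (LEAST k. \<exists>S. finite S \<and> locating_total_dominating G S \<and> card S = k)"

definition level :: "nat \<Rightarrow> nat set" where
  "level i = {2 ^ i .. 2 ^ (i + 1) - 1}"

definition hypertree_verts :: "nat \<Rightarrow> nat set" where
  "hypertree_verts n = {1 .. 2 ^ (n + 1) - 1}"

definition tree_edges :: "nat \<Rightarrow> nat set set" where
  "tree_edges n =
     {{x, y} | x y. x \<in> hypertree_verts n \<and> y \<in> hypertree_verts n \<and> (y = 2 * x \<or> y = 2 * x + 1)}"

definition horizontal_edges :: "nat \<Rightarrow> nat set set" where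
  "horizontal_edges n =
     {{u, v} | u v i. 1 \<le> i \<and> i \<le> n \<and> u \<in> level i \<and> v \<in> level i \<and> v = u + 2 ^ (i - 1)}"

definition hypertree :: "nat \<Rightarrow> nat ugraph" where
  "hypertree n = (hypertree_verts n, tree_edges n \<union> horizontal_edges n)"

end

theory Submission
  imports Defs
begin

text \<open>
  Call the vertex joined to \<open>x\<close> by a horizontal edge its mate. Mates have mates as children,
  so below each pair of mates \<open>x, y\<close> on a level \<open>k \<ge> 1\<close> hangs a block consisting of
  \<open>x, y\<close>, their children and their grandchildren. Every locating-total dominating set meets such a
  block, for \<open>k < n\<close>, in at least three vertices: the four children are dominated from inside the
  block, and if \<open>x, y\<close> alone did this, the two children of \<open>x\<close> would not be separated. The blocks
  based on the levels \<open>n - 1, n - 4, n - 7, \<dots>\<close> are disjoint, and domination of the vertices near the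
  root forces one more vertex if 3 divides \<open>n\<close> and two more if \<open>n \<equiv> 1\<close>.

  The bound is attained by taking all vertices on the levels \<open>n - 1, n - 4, \<dots>\<close>, on each of the levels
  \<open>n, n - 3, \<dots>\<close> the even vertices of the upper half, and the vertex 2.
\<close>

section \<open>Levels, mates and the neighborhoods of the hypertree\<close>

lemma in_level_iff: "v \<in> level i \<longleftrightarrow> 2 ^ i \<le> v \<and> v < 2 * 2 ^ i"
proof -
  have "(0::nat) < 2 ^ i" by simp
  then have "v \<le> 2 * 2 ^ i - 1 \<longleftrightarrow> v < 2 * 2 ^ i" by linarith
  then show ?thesis by (simp add: level_def)
qed

lemma level_unique:
  assumes "v \<in> level i" "v \<in> level j"
  shows "i = j"
proof (rule ccontr)
  assume "i \<noteq> j"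
  then consider "Suc i \<le> j" | "Suc j \<le> i" by linarith
  then show False
  proof cases
    case 1
    then have "(2::nat) ^ Suc i \<le> 2 ^ j" by (intro power_increasing) auto
    then show False using assms by (simp add: in_level_iff)
  next
    case 2
    then have "(2::nat) ^ Suc j \<le> 2 ^ i" by (intro power_increasing) auto
    then show False using assms by (simp add: in_level_iff)
  qed
qed

lemma div2_in_level_iff: "v div 2 \<in> level i \<longleftrightarrow> v \<in> level (Suc i)"
  by (auto simp: in_level_iff)

lemma double_in_level_iff [simp]:
  "2 * v \<in> level (Suc i) \<longleftrightarrow> v \<in> level i"
  "Suc (2 * v) \<in> level (Suc i) \<longleftrightarrow> v \<in> level i"
  by (auto simp: in_level_iff)

lemma in_level_0_iff [simp]: "v \<in> level 0 \<longleftrightarrow> v = 1"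
  by (auto simp: in_level_iff)

lemma in_hypertree_verts_iff: "v \<in> hypertree_verts n \<longleftrightarrow> (\<exists>i\<le>n. v \<in> level i)"
proof (induction n)
  case 0
  show ?case by (auto simp: hypertree_verts_def)
next
  case (Suc n)
  have "v \<in> hypertree_verts (Suc n) \<longleftrightarrow> v \<in> hypertree_verts n \<or> v \<in> level (Suc n)"
  proof -
    have "(1::nat) \<le> 2 ^ n" by simp
    then show ?thesis by (simp add: hypertree_verts_def in_level_iff) linarith
  qed
  with Suc show ?case by (auto simp: le_Suc_eq)
qed

lemma level_in_verts_iff:
  assumes "v \<in> level i"
  shows "v \<in> hypertree_verts n \<longleftrightarrow> i \<le> n"
  using assms level_unique in_hypertree_verts_iff by blast

text \<open>For \<open>i \<ge> 1\<close> the level splits at its midpoint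
  \<open>3 * 2 ^ (i - 1)\<close>; the doubled comparison keeps the exponent at \<open>i\<close>. At
  \<open>i = 0\<close> the value is a default without meaning.\<close>

definition mate :: "nat \<Rightarrow> nat \<Rightarrow> nat" where
  "mate i v = (if 2 * v < 3 * 2 ^ i then v + 2 ^ (i - 1) else v - 2 ^ (i - 1))"

lemma mate_Suc: "mate (Suc i) v = (if v < 3 * 2 ^ i then v + 2 ^ i else v - 2 ^ i)"
  by (simp add: mate_def)

lemma mate_in_level: "v \<in> level (Suc i) \<Longrightarrow> mate (Suc i) v \<in> level (Suc i)"
  by (auto simp: in_level_iff mate_Suc)

text \<open>The level is an interval of length \<open>2 * 2 ^ i\<close>, so exactly one of the two
  shifts of \<open>v\<close> by \<open>2 ^ i\<close> stays inside it: horizontal edges form a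
  perfect matching of each level other than 0.\<close>

lemma eq_mate_iff:
  assumes "v \<in> level (Suc i)"
  shows "u = mate (Suc i) v \<longleftrightarrow> u \<in> level (Suc i) \<and> (v = u + 2 ^ i \<or> u = v + 2 ^ i)"
proof -
  have "(0::nat) < 2 ^ i" by simp
  then show ?thesis using assms by (auto simp: mate_Suc in_level_iff)
qed

lemma horizontal_edge_iff:
  assumes "v \<in> level i" "i \<le> n"
  shows "{u, v} \<in> horizontal_edges n \<longleftrightarrow> 1 \<le> i \<and> u = mate i v"
proof (cases i)
  case 0
  have "{u, v} \<notin> horizontal_edges n"
  proof
    assume "{u, v} \<in> horizontal_edges n"
    then obtain k where "1 \<le> k" "v \<in> level k"
      by (auto simp: horizontal_edges_def doubleton_eq_iff)
    then show False using level_unique[of v 0 k] assms(1) 0 by simp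
  qed
  then show ?thesis using 0 by simp
next
  case (Suc j)
  have "{u, v} \<in> horizontal_edges n \<longleftrightarrow>
      u \<in> level i \<and> (v = u + 2 ^ (i - 1) \<or> u = v + 2 ^ (i - 1))"
  proof
    assume "{u, v} \<in> horizontal_edges n"
    then obtain k where "u \<in> level k" "v \<in> level k" "v = u + 2 ^ (k - 1) \<or> u = v + 2 ^ (k - 1)"
      by (auto simp: horizontal_edges_def doubleton_eq_iff)
    then show "u \<in> level i \<and> (v = u + 2 ^ (i - 1) \<or> u = v + 2 ^ (i - 1))"
      using level_unique assms(1) by blast
  next
    assume "u \<in> level i \<and> (v = u + 2 ^ (i - 1) \<or> u = v + 2 ^ (i - 1))"
    then show "{u, v} \<in> horizontal_edges n"
      using assms Suc unfolding horizontal_edges_def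
      by (fastforce simp: doubleton_eq_iff)
  qed
  then show ?thesis using Suc assms(1) eq_mate_iff by simp
qed

lemma tree_edge_iff:
  assumes "v \<in> level i" "i \<le> n"
  shows "{u, v} \<in> tree_edges n \<longleftrightarrow>
    i < n \<and> (u = 2 * v \<or> u = 2 * v + 1) \<or> 1 \<le> i \<and> u = v div 2"
proof -
  have v: "v \<in> hypertree_verts n" using assms level_in_verts_iff by blast
  have "{u, v} \<in> tree_edges n \<longleftrightarrow> u \<in> hypertree_verts n \<and>
      ((u = 2 * v \<or> u = 2 * v + 1) \<or> (v = 2 * u \<or> v = 2 * u + 1))"
    using v by (auto simp: tree_edges_def doubleton_eq_iff)
  moreover have "u \<in> hypertree_verts n \<longleftrightarrow> i < n" if "u = 2 * v \<or> u = 2 * v + 1"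
  proof -
    have "u \<in> level (Suc i)" using that assms(1) by auto
    then show ?thesis using level_in_verts_iff by (simp add: Suc_le_eq)
  qed
  moreover have "u \<in> hypertree_verts n \<longleftrightarrow> 1 \<le> i" if "v = 2 * u \<or> v = 2 * u + 1"
  proof (cases i)
    case 0
    then have "u = 0" using that assms(1) by auto
    then show ?thesis using 0 by (simp add: hypertree_verts_def)
  next
    case (Suc j)
    then have "u \<in> level j" using that assms(1) by auto
    then show ?thesis using level_in_verts_iff assms(2) Suc by auto
  qed
  moreover have "v = 2 * u \<or> v = 2 * u + 1 \<longleftrightarrow> u = v div 2" by presburger
  ultimately show ?thesis by blast
qed

text \<open>This is the interface to the graph from here on. The guards reflect that the bottom
  level has no children and that the root has neither parent nor mate.\<close>

lemma neighborhood_hypertree_iff: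
  assumes "v \<in> level i" "i \<le> n"
  shows "u \<in> neighborhood (hypertree n) v \<longleftrightarrow>
    i < n \<and> (u = 2 * v \<or> u = 2 * v + 1) \<or> 1 \<le> i \<and> (u = v div 2 \<or> u = mate i v)"
proof -
  have "u \<in> hypertree_verts n"
    if "i < n \<and> (u = 2 * v \<or> u = 2 * v + 1) \<or> 1 \<le> i \<and> (u = v div 2 \<or> u = mate i v)"
  proof -
    have "u \<in> level (Suc i) \<and> i < n \<or> u \<in> level i \<or> 1 \<le> i \<and> u \<in> level (i - 1)"
      using that assms(1) mate_in_level[of v "i - 1"] div2_in_level_iff[of v "i - 1"] by auto
    then show ?thesis using assms(2) unfolding in_hypertree_verts_iff
      by (meson Suc_leI diff_le_self le_trans)
  qed
  then show ?thesis
    using tree_edge_iff[OF assms] horizontal_edge_iff[OF assms]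
    by (auto simp: neighborhood_def hypertree_def)
qed

section \<open>Lower bound: blocks below pairs of mates\<close>

text \<open>Here \<open>x\<close> is meant to lie in the lower half of level \<open>i + 1\<close>, so that its mate is \<open>x + 2 ^ i\<close>.\<close>

definition block :: "nat \<Rightarrow> nat \<Rightarrow> nat set" where
  "block i x = {v. v = x \<or> v div 2 = x \<or> v div 4 = x \<or>
     v = x + 2 ^ i \<or> v div 2 = x + 2 ^ i \<or> v div 4 = x + 2 ^ i}"

lemma finite_block: "finite (block i x)"
proof (rule finite_subset)
  show "block i x \<subseteq> {..4 * (x + 2 ^ i) + 3}" by (auto simp: block_def)
qed simp

lemma three_le_card:
  assumes "finite A" "a \<in> A" "b \<in> A" "c \<in> A" "a \<noteq> b" "a \<noteq> c" "b \<noteq> c"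
  shows "3 \<le> card A"
proof -
  have "card {a, b, c} \<le> card A" using assms by (intro card_mono) auto
  then show ?thesis using assms by simp
qed

lemma block_card_ge_3:
  assumes S: "locating_total_dominating (hypertree n) S"
    and x: "2 * 2 ^ i \<le> x" "x < 3 * 2 ^ i" and i: "Suc (Suc i) \<le> n"
  shows "3 \<le> card (S \<inter> block i x)"
proof -
  define y where "y = x + 2 ^ i"
  note lev = in_level_iff
  have V: "verts (hypertree n) = hypertree_verts n" by (simp add: hypertree_def)
  have lev_ch: "v \<in> level (Suc (Suc i))" if "v div 2 = x \<or> v div 2 = y" for v
    using that x by (auto simp: lev y_def)
  have mates: "mate (Suc (Suc i)) (2 * x) = 2 * y" "mate (Suc (Suc i)) (2 * x + 1) = 2 * y + 1"
    "mate (Suc (Suc i)) (2 * y) = 2 * x" "mate (Suc (Suc i)) (2 * y + 1) = 2 * x + 1"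
    using x by (auto simp: mate_Suc y_def)
  \<comment> \<open>These inequalities keep apart the labels from different levels of the block and
    from the two subtrees.\<close>
  have xy: "x < y" "y < 2 * x" "0 < x" using x by (auto simp: y_def)
  have dom: "(v div 2 \<in> S) \<or> mate (Suc (Suc i)) v \<in> S \<or> 2 * v \<in> S \<or> 2 * v + 1 \<in> S"
    if "v div 2 = x \<or> v div 2 = y" for v
  proof -
    have "v \<in> verts (hypertree n)" using level_in_verts_iff[OF lev_ch[OF that]] i V by simp
    then obtain s where "s \<in> S" "s \<in> neighborhood (hypertree n) v"
      using S unfolding locating_total_dominating_def by blast
    then show ?thesis using neighborhood_hypertree_iff[OF lev_ch[OF that] i, of s] by auto
  qed
  have fin: "finite (S \<inter> block i x)" using finite_block by blast
  have B: "v \<in> block i x" if "v = x \<or> v div 2 = x \<or> v div 4 = x \<or> v = y \<or> v div 2 = y \<or> v div 4 = y" for v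
    using that by (simp add: block_def y_def)
  note three = three_le_card[OF fin]
  \<comment> \<open>Apart from its parent, a child is dominated by its mate or by its own children.
    The alternatives that are combined in one case below are disjoint, so one witness from each
    gives distinct members of the block.\<close>
  have A1: "\<exists>s\<in>S. s = 2 * y \<or> s = 4 * x \<or> s = 4 * x + 1" if "x \<notin> S"
    using dom[of "2 * x"] that mates by auto
  have A2: "\<exists>s\<in>S. s = 2 * y + 1 \<or> s = 4 * x + 2 \<or> s = 4 * x + 3" if "x \<notin> S"
    using dom[of "2 * x + 1"] that mates by (auto simp: numeral_3_eq_3)
  have A3: "\<exists>s\<in>S. s = 2 * x \<or> s = 4 * y \<or> s = 4 * y + 1" if "y \<notin> S"
    using dom[of "2 * y"] that mates by auto
  have A4: "\<exists>s\<in>S. s = 2 * x + 1 \<or> s = 4 * y + 2 \<or> s = 4 * y + 3" if "y \<notin> S"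
    using dom[of "2 * y + 1"] that mates by (auto simp: numeral_3_eq_3)
  consider "x \<notin> S" "y \<notin> S" | "x \<in> S" "y \<notin> S" | "x \<notin> S" "y \<in> S" | "x \<in> S" "y \<in> S" by blast
  then show ?thesis
  proof cases
    case 1
    then obtain a b c where abc: "a \<in> S" "a = 2 * y \<or> a = 4 * x \<or> a = 4 * x + 1"
      "b \<in> S" "b = 2 * y + 1 \<or> b = 4 * x + 2 \<or> b = 4 * x + 3"
      "c \<in> S" "c = 2 * x \<or> c = 4 * y \<or> c = 4 * y + 1"
      using A1 A2 A3 by metis
    have "a \<in> block i x" using abc(2) by (auto intro!: B)
    moreover have "b \<in> block i x" using abc(4) by (auto intro!: B)
    moreover have "c \<in> block i x" using abc(6) by (auto intro!: B)
    moreover have "a \<noteq> b" "a \<noteq> c" "b \<noteq> c" using abc(2,4,6) xy(1,2) by (elim disjE; presburger)+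
    ultimately show ?thesis using abc(1,3,5) by (intro three[of a b c]) auto
  next
    case 2
    then obtain a b where ab: "a \<in> S" "a = 2 * x \<or> a = 4 * y \<or> a = 4 * y + 1"
      "b \<in> S" "b = 2 * x + 1 \<or> b = 4 * y + 2 \<or> b = 4 * y + 3"
      using A3 A4 by metis
    then have "a \<in> block i x" "b \<in> block i x" "x \<in> block i x" by (auto intro!: B)
    moreover have "a \<noteq> b" using ab(2,4) xy(1) by (elim disjE; presburger)
    moreover have "a \<noteq> x" "b \<noteq> x" using ab(2,4) xy by auto
    ultimately show ?thesis using ab(1,3) 2 by (intro three[of a b x]) auto
  next
    case 3
    then obtain a b where ab: "a \<in> S" "a = 2 * y \<or> a = 4 * x \<or> a = 4 * x + 1"
      "b \<in> S" "b = 2 * y + 1 \<or> b = 4 * x + 2 \<or> b = 4 * x + 3"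
      using A1 A2 by metis
    then have "a \<in> block i x" "b \<in> block i x" "y \<in> block i x" by (auto intro!: B)
    moreover have "a \<noteq> b" using ab(2,4) xy(2) by (elim disjE; presburger)
    moreover have "a \<noteq> y" "b \<noteq> y" using ab(2,4) xy by auto
    ultimately show ?thesis using ab(1,3) 3 by (intro three[of a b y]) auto
  next
    case 4
    \<comment> \<open>The candidates are the two children of \<open>x\<close> and all their
      neighbors except \<open>x\<close>. With none of them in \<open>S\<close>, both children lie
      outside \<open>S\<close> and see exactly \<open>{x}\<close>.\<close>
    have "\<exists>c\<in>S. c div 2 = x \<or> c div 4 = x \<or> c div 2 = y"
    proof (rule ccontr)
      assume none: "\<not> ?thesis"
      have N: "neighborhood (hypertree n) v \<inter> S = {x}" if v: "v = 2 * x \<or> v = 2 * x + 1" for v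
      proof -
        have "v div 2 = x \<or> v div 2 = y" using v by auto
        note nb = neighborhood_hypertree_iff[OF lev_ch[OF this] i]
        have "2 * v \<notin> S" "2 * v + 1 \<notin> S" "mate (Suc (Suc i)) v \<notin> S" "v div 2 = x"
          using none v mates by auto
        then show ?thesis using 4 by (auto simp: nb)
      qed
      have "2 * x \<in> verts (hypertree n) - S" "2 * x + 1 \<in> verts (hypertree n) - S"
        using none level_in_verts_iff[OF lev_ch] i V by auto
      then have "neighborhood (hypertree n) (2 * x) \<inter> S \<noteq> neighborhood (hypertree n) (2 * x + 1) \<inter> S"
        using S unfolding locating_total_dominating_def
        by (metis n_not_Suc_n Suc_eq_plus1)
      then show False using N by simp
    qed
    then obtain c where c: "c \<in> S" "c div 2 = x \<or> c div 4 = x \<or> c div 2 = y" by blast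
    then have "c \<in> block i x" "x \<in> block i x" "y \<in> block i x" by (auto intro!: B)
    moreover have "x \<noteq> y" "x \<noteq> c" "y \<noteq> c" using c(2) xy by auto
    ultimately show ?thesis using c(1) 4 by (intro three[of x y c]) auto
  qed
qed

text \<open>Three further levels contribute three vertices for each of the \<open>2 ^ Suc n\<close>
  pairs of mates on level \<open>n + 2\<close>.\<close>

fun ltd_size :: "nat \<Rightarrow> nat" where
  "ltd_size 0 = 1"
| "ltd_size (Suc 0) = 2"
| "ltd_size (Suc (Suc 0)) = 3"
| "ltd_size (Suc (Suc (Suc n))) = ltd_size n + 3 * 2 ^ Suc n"

text \<open>The correction term depends on \<open>n mod 3\<close> only, since
  \<open>7 * (3 * 2 ^ (n + 1)) = 3 * 2 ^ (n + 4) - 3 * 2 ^ (n + 1)\<close>.\<close>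

lemma ltd_size_closed:
  "7 * real (ltd_size n) = 3 * 2 ^ (n + 1) +
     (if n mod 3 = 0 then 1 else if n mod 3 = 1 then 2 else - 3)"
proof (induction n rule: ltd_size.induct)
  case (4 n)
  have "Suc (Suc (Suc n)) mod 3 = n mod 3" by presburger
  with 4 show ?case by (simp add: algebra_simps)
qed auto

text \<open>The lower half of level \<open>i + 1\<close> has \<open>2 ^ i\<close> vertices; their
  blocks are disjoint and stay within the levels \<open>i + 1\<close> to
  \<open>i + 3\<close>.\<close>

lemma blocks_card_ge:
  assumes S: "locating_total_dominating (hypertree n) S" and i: "Suc (Suc i) \<le> n"
  shows "3 * 2 ^ i \<le> card (S \<inter> {2 * 2 ^ i..<16 * 2 ^ i})"
proof -
  let ?X = "{2 * 2 ^ i..<3 * 2 ^ i} :: nat set"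
  have "3 * 2 ^ i = (\<Sum>x\<in>?X. 3 :: nat)" by simp
  also have "\<dots> \<le> (\<Sum>x\<in>?X. card (S \<inter> block i x))"
    by (intro sum_mono block_card_ge_3[OF S _ _ i]) auto
  also have "\<dots> = card (\<Union>x\<in>?X. S \<inter> block i x)"
  proof (rule card_UN_disjoint[symmetric])
    show "\<forall>x\<in>?X. \<forall>y\<in>?X. x \<noteq> y \<longrightarrow> (S \<inter> block i x) \<inter> (S \<inter> block i y) = {}"
      by (auto simp: block_def)
  qed (auto simp: finite_block)
  also have "\<dots> \<le> card (S \<inter> {2 * 2 ^ i..<16 * 2 ^ i})"
    by (intro card_mono) (auto simp: block_def)
  finally show ?thesis .
qed

text \<open>The cut-off \<open>2 ^ (m + 2)\<close> includes level \<open>m + 1\<close>, because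
  vertices on level \<open>m\<close> may be dominated by their children. The induction step from
  \<open>m\<close> to \<open>m + 3\<close> adds the blocks that fill the levels \<open>m + 2\<close>
  to \<open>m + 4\<close>.\<close>

lemma ltd_size_le_card:
  assumes S: "locating_total_dominating (hypertree n) S" and n: "1 \<le> n"
  shows "m \<le> n \<Longrightarrow> ltd_size m \<le> card (S \<inter> {..<2 ^ (m + 2)})"
proof (induction m rule: ltd_size.induct)
  have dom: "\<exists>s\<in>S. s \<in> neighborhood (hypertree n) v" if "v \<in> level i" "i \<le> n" for v i
    using S that level_in_verts_iff unfolding locating_total_dominating_def
    by (metis fst_conv hypertree_def)
  have d1: "2 \<in> S \<or> 3 \<in> S"
    using dom[of 1 0] neighborhood_hypertree_iff[of 1 0 n] by auto
  {
    case 1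
    have "S \<inter> {..<2 ^ (0 + 2)} \<noteq> {}" using d1 by auto
    then show ?case by (simp add: Suc_le_eq card_gt_0_iff)
  next
    case 2
    have two: "2 \<in> level 1" "3 \<in> level 1" by (auto simp: in_level_iff)
    have m: "mate 1 2 = 3" "mate 1 3 = 2" by (auto simp: mate_def)
    \<comment> \<open>Neighborhoods are open, so whichever of 2 and 3 lies in \<open>S\<close> needs
      a second member of \<open>S\<close> to dominate it.\<close>
    have "2 \<in> S \<Longrightarrow> \<exists>s\<in>S. s \<in> {1,3,4,5}"
      using dom[OF two(1) n] neighborhood_hypertree_iff[OF two(1) n] m by auto
    moreover have "3 \<in> S \<Longrightarrow> \<exists>s\<in>S. s \<in> {1,2,6,7}"
      using dom[OF two(2) n] neighborhood_hypertree_iff[OF two(2) n] m by auto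
    ultimately obtain a b where "a \<in> S" "b \<in> S" "a \<noteq> b" "a < 8" "b < 8"
      using d1 by fastforce
    then have "card {a, b} \<le> card (S \<inter> {..<2 ^ (Suc 0 + 2)})" by (intro card_mono) auto
    then show ?case using \<open>a \<noteq> b\<close> by simp
  next
    case 3
    have "3 * 2 ^ 0 \<le> card (S \<inter> {2 * 2 ^ 0..<16 * 2 ^ 0})"
      using blocks_card_ge[OF S, of 0] 3 by simp
    also have "\<dots> \<le> card (S \<inter> {..<2 ^ (Suc (Suc 0) + 2)})" by (intro card_mono) auto
    finally show ?case by simp
  next
    case (4 m)
    let ?L = "S \<inter> {..<2 ^ (m + 2)}" and ?H = "S \<inter> {2 * 2 ^ Suc m..<16 * 2 ^ Suc m}"
    have "ltd_size (Suc (Suc (Suc m))) \<le> card ?L + card ?H"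
      using 4 blocks_card_ge[OF S, of "Suc m"] by simp
    also have "\<dots> = card (?L \<union> ?H)" by (intro card_Un_disjoint[symmetric]) auto
    also have "\<dots> \<le> card (S \<inter> {..<2 ^ (Suc (Suc (Suc m)) + 2)})" by (intro card_mono) auto
    finally show ?case .
  }
qed

section \<open>The extremal set and its cardinality\<close>

text \<open>Levels are classified by the residue modulo 3 of their distance \<open>n - i\<close>
  from the bottom. The upper half is cut off by the same threshold as in \<open>mate\<close>, and
  the vertex 2 dominates the root.\<close>

definition ltd_set :: "nat \<Rightarrow> nat set" where
  "ltd_set n = insert 2 {v. \<exists>i\<le>n. v \<in> level i \<and>
     ((n - i) mod 3 = 1 \<or> (n - i) mod 3 = 0 \<and> even v \<and> 3 * 2 ^ i \<le> 2 * v)}"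

lemma level_in_ltd_set_iff:
  assumes "v \<in> level i" "i \<le> n"
  shows "v \<in> ltd_set n \<longleftrightarrow> v = 2 \<or> (n - i) mod 3 = 1 \<or>
    (n - i) mod 3 = 0 \<and> even v \<and> 3 * 2 ^ i \<le> 2 * v"
proof -
  have "v \<in> level j \<longleftrightarrow> j = i" for j using assms(1) level_unique by blast
  then show ?thesis using assms(2) by (simp add: ltd_set_def)
qed

text \<open>Residues on the levels up to \<open>n\<close> do not change, and level
  \<open>n + 1\<close> gets residue 2 and adds nothing. The even vertices in the upper half of level
  \<open>n + 3\<close> are the doubles of the upper half of level \<open>n + 2\<close>.\<close>

lemma ltd_set_step:
  "ltd_set (Suc (Suc (Suc n))) = ltd_set n \<union> level (n + 2) \<union>
     (*) 2 ` {3 * 2 ^ (n + 1)..<4 * 2 ^ (n + 1)}"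
proof (rule set_eqI)
  fix v
  let ?n = "Suc (Suc (Suc n))"
  define P where "P N i \<longleftrightarrow> v \<in> level i \<and>
    ((N - i) mod 3 = 1 \<or> (N - i) mod 3 = 0 \<and> even v \<and> 3 * 2 ^ i \<le> 2 * v)" for N i :: nat
  have mem: "v \<in> ltd_set N \<longleftrightarrow> v = 2 \<or> (\<exists>i\<le>N. P N i)" for N
    by (simp add: ltd_set_def P_def)
  have low: "P ?n i \<longleftrightarrow> P n i" if "i \<le> n" for i
  proof -
    have "?n - i = (n - i) + 3" using that by simp
    then have "(?n - i) mod 3 = (n - i) mod 3" by (simp only: mod_add_self2)
    then show ?thesis by (simp add: P_def)
  qed
  have img: "w \<in> (*) 2 ` {a..<b} \<longleftrightarrow> even w \<and> 2 * a \<le> w \<and> w < 2 * b" for a b w :: nat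
  proof
    assume "even w \<and> 2 * a \<le> w \<and> w < 2 * b"
    then show "w \<in> (*) 2 ` {a..<b}" by (intro image_eqI[of _ _ "w div 2"]) auto
  qed auto
  have "\<not> P ?n (Suc n)" "P ?n (Suc (Suc n)) \<longleftrightarrow> v \<in> level (n + 2)"
    "P ?n ?n \<longleftrightarrow> v \<in> (*) 2 ` {3 * 2 ^ (n + 1)..<4 * 2 ^ (n + 1)}"
    unfolding img by (auto simp: P_def in_level_iff)
  moreover have "(\<exists>i\<le>?n. P ?n i) \<longleftrightarrow>
      (\<exists>i\<le>n. P ?n i) \<or> P ?n (Suc n) \<or> P ?n (Suc (Suc n)) \<or> P ?n ?n"
    by (auto simp: le_Suc_eq)
  ultimately show "v \<in> ltd_set ?n \<longleftrightarrow> v \<in> ltd_set n \<union> level (n + 2) \<union>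
     (*) 2 ` {3 * 2 ^ (n + 1)..<4 * 2 ^ (n + 1)}"
    unfolding mem Un_iff using low by blast
qed

text \<open>The bound stops just below level \<open>n + 2\<close>, where the new part in
  \<open>ltd_set_step\<close> begins. The sharper \<open>2 ^ (n + 1)\<close> fails at
  \<open>n = 0\<close> because of the element 2.\<close>

lemma ltd_set_bound: "v \<in> ltd_set n \<Longrightarrow> v < 2 ^ (n + 2)"
proof -
  assume "v \<in> ltd_set n"
  then consider "v = 2" | i where "i \<le> n" "v \<in> level i" unfolding ltd_set_def by blast
  then show ?thesis
  proof cases
    case 1
    have "(1::nat) \<le> 2 ^ n" by simp
    then show ?thesis unfolding 1 power_add power2_eq_square by linarith
  next
    case 2
    then have "(2::nat) ^ i \<le> 2 ^ n" by (intro power_increasing) auto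
    then show ?thesis using 2(2) unfolding in_level_iff power_add power2_eq_square by linarith
  qed
qed

lemma finite_ltd_set: "finite (ltd_set n)"
  by (rule finite_subset[of _ "{..<2 ^ (n + 2)}"]) (auto dest: ltd_set_bound)

lemma card_ltd_set: "card (ltd_set n) = ltd_size n"
proof (induction n rule: ltd_size.induct)
  case 1
  \<comment> \<open>Here 2 is not a vertex of the graph; the case only starts the count for
    multiples of 3.\<close>
  have "ltd_set 0 = {2}" by (auto simp: ltd_set_def)
  then show ?case by simp
next
  case 2
  have "ltd_set (Suc 0) = {1, 2}"
    by (auto simp: ltd_set_def le_Suc_eq in_level_iff)
  then show ?case by simp
next
  case 3
  have "v \<in> level (Suc (Suc 0)) \<and> even v \<and> 6 \<le> v \<longleftrightarrow> v = 6" for v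
    unfolding in_level_iff by (simp del: One_nat_def) presburger
  moreover have "v \<in> level (Suc 0) \<longleftrightarrow> v = 2 \<or> v = 3" for v
    by (auto simp: in_level_iff)
  ultimately have "ltd_set (Suc (Suc 0)) = {2, 3, 6}"
    by (auto simp: ltd_set_def le_Suc_eq conj_disj_distribR ex_disj_distrib)
  then show ?case by simp
next
  case (4 n)
  let ?E = "(*) 2 ` {3 * 2 ^ (n + 1)..<4 * 2 ^ (n + 1)} :: nat set"
  have "card ?E = card {3 * 2 ^ (n + 1)..<4 * 2 ^ (n + 1) :: nat}"
    by (intro card_image) (auto simp: inj_on_def)
  moreover have "card (level (n + 2)) = 2 ^ (n + 2)" by (simp add: level_def)
  moreover have "card (level (n + 2) \<union> ?E) = card (level (n + 2)) + card ?E"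
    by (intro card_Un_disjoint) (auto simp: level_def)
  moreover have "card (ltd_set n \<union> (level (n + 2) \<union> ?E)) =
      card (ltd_set n) + card (level (n + 2) \<union> ?E)"
    by (intro card_Un_disjoint)
      (auto simp: finite_ltd_set level_def dest!: ltd_set_bound)
  ultimately show ?case using 4 by (simp add: ltd_set_step Un_assoc)
qed


section \<open>The extremal set is locating-total dominating\<close>

text \<open>Besides its own children, \<open>u\<close> has only a mate and a parent as neighbors,
  and these lie on different levels, whereas \<open>2 * v\<close> and \<open>2 * v + 1\<close> share
  a level.\<close>

lemma eq_if_children_in_neighborhood:
  assumes u: "u \<in> level i" "i \<le> n" and v: "v \<in> level j"
    and ch: "2 * v \<in> neighborhood (hypertree n) u" "2 * v + 1 \<in> neighborhood (hypertree n) u"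
  shows "u = v"
proof -
  have nb: "w = 2 * u \<or> w = 2 * u + 1 \<or> w \<in> level i \<and> w = mate i u \<or>
      w \<in> level (i - 1) \<and> 1 \<le> i \<and> w = u div 2"
    if "w \<in> neighborhood (hypertree n) u" for w
    using that neighborhood_hypertree_iff[OF u] mate_in_level[of u "i - 1"]
      div2_in_level_iff[of u "i - 1"] u(1) by auto
  have lev: "2 * v \<in> level (Suc j)" "2 * v + 1 \<in> level (Suc j)" using v by auto
  show ?thesis
  proof (rule ccontr)
    assume "u \<noteq> v"
    then have "2 * v \<noteq> 2 * u" "2 * v \<noteq> 2 * u + 1" "2 * v + 1 \<noteq> 2 * u" "2 * v + 1 \<noteq> 2 * u + 1"
      by presburger+
    then consider "2 * v = 2 * v + 1" | "1 \<le> i" "2 * v \<in> level i" "2 * v + 1 \<in> level (i - 1)"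
      | "1 \<le> i" "2 * v \<in> level (i - 1)" "2 * v + 1 \<in> level i"
      using nb[OF ch(1)] nb[OF ch(2)] by metis
    then show False
    proof cases
      case 2
      then have "i = Suc j" "i - 1 = Suc j" using lev level_unique by blast+
      then show False by simp
    next
      case 3
      then have "i = Suc j" "i - 1 = Suc j" using lev level_unique by blast+
      then show False by simp
    qed simp
  qed
qed

lemma diff_mod_3:
  fixes i n :: nat
  assumes "i < n"
  shows "(n - i) mod 3 = 1 \<longleftrightarrow> (n - Suc i) mod 3 = 0"
    and "(n - i) mod 3 = 2 \<longleftrightarrow> (n - Suc i) mod 3 = 1"
    and "(n - i) mod 3 = 0 \<longleftrightarrow> (n - Suc i) mod 3 = 2"
proof -
  have "n - i = Suc (n - Suc i)" using assms by simp
  then show "(n - i) mod 3 = 1 \<longleftrightarrow> (n - Suc i) mod 3 = 0"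
    "(n - i) mod 3 = 2 \<longleftrightarrow> (n - Suc i) mod 3 = 1"
    "(n - i) mod 3 = 0 \<longleftrightarrow> (n - Suc i) mod 3 = 2"
    by (auto simp: mod_Suc split: if_splits)
qed

text \<open>The root is dominated by 2. Any other vertex is dominated by its parent, its mate or a
  child, according to the residue 0, 1 or 2 of its level.\<close>

lemma ltd_set_total_dominating:
  assumes n: "1 \<le> n" and v: "v \<in> level i" "i \<le> n"
  shows "\<exists>s\<in>ltd_set n. s \<in> neighborhood (hypertree n) v"
proof -
  note nb = neighborhood_hypertree_iff[OF v]
  consider "i = 0" | "1 \<le> i" "(n - i) mod 3 = 0" | "1 \<le> i" "(n - i) mod 3 = 1" | "(n - i) mod 3 = 2"
    by linarith
  then show ?thesis
  proof cases
    case 1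
    then have "2 \<in> neighborhood (hypertree n) v" using nb n v by auto
    then show ?thesis by (auto simp: ltd_set_def)
  next
    case 2
    then have "v div 2 \<in> level (i - 1)" using v div2_in_level_iff[of v "i - 1"] by simp
    moreover have "(n - (i - 1)) mod 3 = 1" using 2 v(2) diff_mod_3(1)[of "i - 1" n] by simp
    ultimately have "v div 2 \<in> ltd_set n" using level_in_ltd_set_iff v(2) by auto
    then show ?thesis using nb 2 by blast
  next
    case 3
    then have "mate i v \<in> level i" using v mate_in_level[of v "i - 1"] by simp
    then have "mate i v \<in> ltd_set n" using level_in_ltd_set_iff v(2) 3 by auto
    then show ?thesis using nb 3 by blast
  next
    case 4
    then have "i < n" using v(2) by (cases "i = n") auto
    moreover have "(n - Suc i) mod 3 = 1" using 4 \<open>i < n\<close> diff_mod_3(2) by simp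
    ultimately have "2 * v \<in> ltd_set n"
      using level_in_ltd_set_iff[of "2 * v" "Suc i" n] v(1) by auto
    then show ?thesis using nb \<open>i < n\<close> by blast
  qed
qed

text \<open>By \<open>eq_if_children_in_neighborhood\<close>, seeing both children identifies a
  vertex on a level of residue 2.\<close>

lemma ltd_set_children:
  assumes v: "v \<in> level i" "i \<le> n" and c: "(n - i) mod 3 = 2"
  shows "2 * v \<in> neighborhood (hypertree n) v \<inter> ltd_set n"
    and "2 * v + 1 \<in> neighborhood (hypertree n) v \<inter> ltd_set n"
proof -
  have "i < n" using c v(2) by (cases "i = n") auto
  moreover have "(n - Suc i) mod 3 = 1" using c \<open>i < n\<close> diff_mod_3(2) by simp
  ultimately show "2 * v \<in> neighborhood (hypertree n) v \<inter> ltd_set n"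
    "2 * v + 1 \<in> neighborhood (hypertree n) v \<inter> ltd_set n"
    using level_in_ltd_set_iff[of _ "Suc i" n] v neighborhood_hypertree_iff[OF v] by auto
qed

lemma ltd_set_parent:
  assumes v: "v \<in> level (Suc i)" "Suc i \<le> n" and c: "(n - Suc i) mod 3 = 0"
  shows "v div 2 \<in> neighborhood (hypertree n) v \<inter> ltd_set n"
    and "neighborhood (hypertree n) v \<inter> ltd_set n \<subseteq> {v div 2, mate (Suc i) v}"
proof -
  have "v div 2 \<in> level i" using v div2_in_level_iff by simp
  moreover have "(n - i) mod 3 = 1" using c v(2) diff_mod_3(1) by simp
  ultimately have "v div 2 \<in> ltd_set n" using level_in_ltd_set_iff v(2) by auto
  then show "v div 2 \<in> neighborhood (hypertree n) v \<inter> ltd_set n"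
    using neighborhood_hypertree_iff[OF v] by auto
  have "2 * v \<notin> ltd_set n \<and> 2 * v + 1 \<notin> ltd_set n" if "Suc i < n"
  proof -
    have "(n - Suc (Suc i)) mod 3 = 2" using that c diff_mod_3(3) by simp
    \<comment> \<open>The children lie on a level of residue 2, where only the label 2 could belong
      to the set, and that is a child of the root.\<close>
    moreover have "v \<noteq> 1" using v(1) level_unique[of v 0 "Suc i"] by auto
    ultimately show ?thesis
      using level_in_ltd_set_iff[of _ "Suc (Suc i)" n] v(1) that by auto
  qed
  then show "neighborhood (hypertree n) v \<inter> ltd_set n \<subseteq> {v div 2, mate (Suc i) v}"
    using neighborhood_hypertree_iff[OF v] by auto
qed

text \<open>In the upper half of the level the even sibling belongs to the set; in the lower half the even
  sibling is told apart by its mate.\<close>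

lemma ltd_set_siblings:
  assumes p: "2 * p \<in> level (Suc i)" "Suc i \<le> n" and c: "(n - Suc i) mod 3 = 0"
    and out: "2 * p \<notin> ltd_set n"
  shows "neighborhood (hypertree n) (2 * p) \<inter> ltd_set n \<noteq>
    neighborhood (hypertree n) (2 * p + 1) \<inter> ltd_set n"
proof -
  have "2 * p < 3 * 2 ^ i" "p \<noteq> 1"
    using out level_in_ltd_set_iff[OF p] c by auto
  \<comment> \<open>As 2 belongs to the set, \<open>p\<close> is not the root. Hence
    \<open>2 ^ i\<close> is even, and the mate of the even sibling is even and in the upper
    half.\<close>
  moreover obtain k where "i = Suc k"
    using p(1) \<open>p \<noteq> 1\<close> by (cases i) auto
  ultimately have m: "mate (Suc i) (2 * p) = 2 * p + 2 ^ i" "mate (Suc i) (2 * p + 1) = 2 * p + 1 + 2 ^ i"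
    by (auto simp: mate_Suc)
  have "mate (Suc i) (2 * p) \<in> ltd_set n"
    using level_in_ltd_set_iff[OF mate_in_level[OF p(1)] p(2)] c m p(1) \<open>i = Suc k\<close>
    by (auto simp: in_level_iff)
  then have "mate (Suc i) (2 * p) \<in> neighborhood (hypertree n) (2 * p) \<inter> ltd_set n"
    using neighborhood_hypertree_iff[OF p] by auto
  moreover have "2 * p + 1 \<in> level (Suc i)" using p(1) by simp
  note ltd_set_parent(2)[OF this p(2) c]
  ultimately show ?thesis using m by auto
qed

text \<open>If the parents differed, each would have to be the mate of the other vertex, placing
  \<open>u\<close> one level below \<open>v\<close> and \<open>v\<close> one level below
  \<open>u\<close>.\<close>

lemma ltd_set_parent_eq:
  assumes u: "u \<in> level (Suc i)" "Suc i \<le> n" "(n - Suc i) mod 3 = 0"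
    and v: "v \<in> level (Suc j)" "Suc j \<le> n" "(n - Suc j) mod 3 = 0"
    and eq: "neighborhood (hypertree n) u \<inter> ltd_set n = neighborhood (hypertree n) v \<inter> ltd_set n"
  shows "u div 2 = v div 2"
proof (rule ccontr)
  assume "u div 2 \<noteq> v div 2"
  then have "u div 2 = mate (Suc j) v" "v div 2 = mate (Suc i) u"
    using ltd_set_parent[OF u] ltd_set_parent[OF v] eq by auto
  then have "u div 2 \<in> level (Suc j)" "v div 2 \<in> level (Suc i)"
    using mate_in_level u(1) v(1) by auto
  moreover have "u div 2 \<in> level i" "v div 2 \<in> level j"
    using u(1) v(1) div2_in_level_iff by auto
  ultimately have "i = Suc j" "j = Suc i" using level_unique by blast+
  then show False by simp
qed

text \<open>A shared trace would put the parent of \<open>v\<close> on level 1 and \<open>v\<close>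
  on level 2, which has residue 1 when 3 divides \<open>n\<close>.\<close>

lemma ltd_set_root:
  assumes n: "1 \<le> n" "n mod 3 = 0" and v: "v \<in> level (Suc j)" "Suc j \<le> n" "(n - Suc j) mod 3 = 0"
  shows "neighborhood (hypertree n) 1 \<inter> ltd_set n \<noteq> neighborhood (hypertree n) v \<inter> ltd_set n"
proof
  assume eq: "neighborhood (hypertree n) 1 \<inter> ltd_set n = neighborhood (hypertree n) v \<inter> ltd_set n"
  have "v div 2 \<in> neighborhood (hypertree n) 1"
    using eq ltd_set_parent(1)[OF v] by blast
  then have "v div 2 = 2 \<or> v div 2 = 3" using neighborhood_hypertree_iff[of 1 0 n] by auto
  then have "v div 2 \<in> level 1" by (auto simp: in_level_iff)
  then have "j = 1" using level_unique v(1) div2_in_level_iff by blast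
  then show False using n v diff_mod_3[of 1 n] diff_mod_3[of 0 n] by simp
qed

text \<open>Levels of residue 1 lie inside the set. A vertex of residue 2 is known by its children;
  two vertices of residue 0 other than the root have the same parent by
  \<open>ltd_set_parent_eq\<close>, and siblings are separated by
  \<open>ltd_set_siblings\<close>.\<close>

lemma ltd_set_locating:
  assumes n: "1 \<le> n"
    and u: "u \<in> level i" "i \<le> n" "u \<notin> ltd_set n"
    and v: "v \<in> level j" "j \<le> n" "v \<notin> ltd_set n"
    and eq: "neighborhood (hypertree n) u \<inter> ltd_set n = neighborhood (hypertree n) v \<inter> ltd_set n"
  shows "u = v"
proof (cases "(n - i) mod 3 = 2 \<or> (n - j) mod 3 = 2")
  case True
  then show ?thesis
    using ltd_set_children[OF u(1,2)] ltd_set_children[OF v(1,2)] eq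
      eq_if_children_in_neighborhood[OF u(1,2) v(1)] eq_if_children_in_neighborhood[OF v(1,2) u(1)]
    by blast
next
  case False
  have "(n - i) mod 3 \<noteq> 1" "(n - j) mod 3 \<noteq> 1"
    using u v level_in_ltd_set_iff by blast+
  with False have c: "(n - i) mod 3 = 0" "(n - j) mod 3 = 0" by linarith+
  show ?thesis
  proof (cases i)
    case 0
    then show ?thesis using ltd_set_root[OF n, of v "j - 1"] u v c eq by (cases j) auto
  next
    case i: (Suc i')
    show ?thesis
    proof (cases j)
      case 0
      then show ?thesis using ltd_set_root[OF n, of u "i - 1"] u v c eq i by auto
    next
      case j: (Suc j')
      have p: "u div 2 = v div 2"
        using ltd_set_parent_eq[OF u(1,2)[unfolded i] _ v(1,2)[unfolded j] _ eq] c i j by simp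
      then have "i' = j'" using u(1) v(1) i j level_unique by (metis div2_in_level_iff)
      show ?thesis
      proof (rule ccontr)
        assume "u \<noteq> v"
        then have "u = 2 * (u div 2) \<and> v = 2 * (u div 2) + 1 \<or>
            v = 2 * (u div 2) \<and> u = 2 * (u div 2) + 1" using p by presburger
        then consider "u = 2 * (u div 2)" "v = 2 * (u div 2) + 1"
          | "v = 2 * (u div 2)" "u = 2 * (u div 2) + 1" by blast
        then show False
        proof cases
          case 1
          then show False using ltd_set_siblings[of "u div 2" i' n] u c i eq by metis
        next
          case 2
          then show False using ltd_set_siblings[of "u div 2" j' n] v c j eq by metis
        qed
      qed
    qed
  qed
qed

lemma locating_total_dominating_ltd_set:
  assumes n: "1 \<le> n"
  shows "locating_total_dominating (hypertree n) (ltd_set n)"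
proof -
  have V: "verts (hypertree n) = hypertree_verts n" by (simp add: hypertree_def)
  have "2 \<in> level 1" by (simp add: in_level_iff)
  then have "ltd_set n \<subseteq> hypertree_verts n"
    using n by (auto simp: ltd_set_def in_hypertree_verts_iff)
  then show ?thesis
    unfolding locating_total_dominating_def V
  proof (intro conjI ballI impI)
    fix v assume "v \<in> hypertree_verts n"
    then show "\<exists>s\<in>ltd_set n. s \<in> neighborhood (hypertree n) v"
      using ltd_set_total_dominating[OF n] by (auto simp: in_hypertree_verts_iff)
  next
    fix u v
    assume "u \<in> hypertree_verts n - ltd_set n" "v \<in> hypertree_verts n - ltd_set n" "u \<noteq> v"
    then show "neighborhood (hypertree n) u \<inter> ltd_set n \<noteq> neighborhood (hypertree n) v \<inter> ltd_set n"
      using ltd_set_locating[OF n] unfolding in_hypertree_verts_iff Diff_iff by metis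
  qed
qed

section \<open>The exact value\<close>

lemma locating_total_domination_number_hypertree:
  assumes n: "1 \<le> n"
  shows "locating_total_domination_number (hypertree n) = ltd_size n"
  unfolding locating_total_domination_number_def
proof (rule Least_equality)
  show "\<exists>S. finite S \<and> locating_total_dominating (hypertree n) S \<and> card S = ltd_size n"
    using finite_ltd_set locating_total_dominating_ltd_set[OF n] card_ltd_set by blast
next
  fix k
  assume "\<exists>S. finite S \<and> locating_total_dominating (hypertree n) S \<and> card S = k"
  then obtain S where S: "finite S" "locating_total_dominating (hypertree n) S" "card S = k"
    by blast
  have "ltd_size n \<le> card (S \<inter> {..<2 ^ (n + 2)})"
    using ltd_size_le_card[OF S(2) n] by simp
  also have "\<dots> \<le> card S" using S(1) by (intro card_mono) auto
  finally show "ltd_size n \<le> k" using S(3) by simp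
qed

theorem theorem4:
  fixes n :: nat and G :: "nat ugraph"
  assumes "n \<ge> 1" and "G = hypertree n"
  shows "([n = 0] (mod 3) \<longrightarrow>
            real (locating_total_domination_number G) = 1 / 7 * (3 * 2 ^ (n + 1) + 1)) \<and>
         ([n = 1] (mod 3) \<longrightarrow>
            real (locating_total_domination_number G) = 2 / 7 * (3 * 2 ^ n + 1)) \<and>
         ([n = 2] (mod 3) \<longrightarrow>
            real (locating_total_domination_number G) = 3 / 7 * (2 ^ (n + 1) - 1))"
  using ltd_size_closed[of n] locating_total_domination_number_hypertree[OF assms(1)] assms(2)
  by (auto simp: cong_def)

end
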